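(* Let $G = \mathbb{Z}_2 \wr \mathbb{Z}$ be the lamplighter group, realized as $X_0 \times \mathbb{Z}$ with $X_0 = \{x \in \{0,1\}^{\mathbb{Z}} : \sum_i x_i < \infty\}$ and multiplication $(x,m)(y,n) = (x + \sigma^m(y), m+n)$, where addition is coordinatewise modulo $2$ and $\sigma^m(y)_i = y_{i-m}$. Let $a = (0^{\mathbb{Z}}, 1)$ and $b = (x,1)$, where $x$ is the characteristic function of $\{0\}$, and let $S = \{e, a, b, a^{-1}, b^{-1}\}$. Then there is an $S$-horoball in $G$ which is not coarsely connected and which is a limit of Busemann horoballs (with respect to $S$).
   Context: For a group $G$ with finite symmetric generating set $S \ni e_G$, $|g|_S$ is the minimal $\ell \ge 0$ such that $g$ is a product of $\ell$ elements of $S$, $d_S(g,h) = |g^{-1}h|_S$, and $B_{S,r}(g) = \{h \in G : d_S(g,h)\le r\}$. Subsets of $G$ carry the product (Cantor) topology of $\{0,1\}^G$: $P_i \to P$ means that for each $g\in G$, $g \in P_i \iff g\in P$ for all large $i$. A path is a sequence in $G$ with each next element $g_{i+1} \in g_iS$; an infinite geodesic is a path $p : \mathbb{N}\to G$ with $d_S(p(0),p(n)) = n$ for all $n$. Let $P\subset G$ with $P\neq\emptyset, G$. $P$ is a Busemann horoball if $P = \bigcup_n B_{S,n}(p(n))$ for some infinite geodesic $p$. $P$ is an $S$-horoball if $P = \lim_i B_{S,n_i}(g_i)$ for some $g_i\in G$, $n_i\in\mathbb{N}$ with $n_i\to\infty$. A metric space $(M,d)$ is coarsely connected if for some $t>0$,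 for all $x,y\in M$ there exist $x_0 = x, x_1,\dots,x_k = y$ in $M$ with $d(x_i,x_{i+1})<t$ for all $0 \le i<k$. A subset of a finitely generated group is coarsely connected if it is coarsely connected under the restriction of the word metric of some finite generating set (this does not depend on the generating set). *)

theory Defs
  imports Complex_Main "HOL-Algebra.Generated_Groups" "HOL-Library.Z2"
begin

section \<open>Word metrics\<close>

definition finite_symmetric_generating_set :: "('a, 'b) monoid_scheme \<Rightarrow> 'a set \<Rightarrow> bool"
  where "finite_symmetric_generating_set G S \<longleftrightarrow>
    finite S \<and> S \<subseteq> carrier G \<and> \<one>\<^bsub>G\<^esub> \<in> S \<and> (\<forall>s\<in>S. inv\<^bsub>G\<^esub> s \<in> S) \<and> generate G S = carrier G"

definition word_product :: "('a, 'b) monoid_scheme \<Rightarrow> 'a list \<Rightarrow> 'a"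
  where "word_product G w = foldr (\<lambda>x y. x \<otimes>\<^bsub>G\<^esub> y) w \<one>\<^bsub>G\<^esub>"

definition word_length :: "('a, 'b) monoid_scheme \<Rightarrow> 'a set \<Rightarrow> 'a \<Rightarrow> nat"
  where "word_length G S g =
    (LEAST l. \<exists>w. set w \<subseteq> S \<and> length w = l \<and> word_product G w = g)"

definition word_dist :: "('a, 'b) monoid_scheme \<Rightarrow> 'a set \<Rightarrow> 'a \<Rightarrow> 'a \<Rightarrow> nat"
  where "word_dist G S g h = word_length G S (inv\<^bsub>G\<^esub> g \<otimes>\<^bsub>G\<^esub> h)"

definition word_ball :: "('a, 'b) monoid_scheme \<Rightarrow> 'a set \<Rightarrow> nat \<Rightarrow> 'a \<Rightarrow> 'a set"
  where "word_ball G S r g = {h \<in> carrier G. word_dist G S g h \<le> r}"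

section \<open>Horoballs\<close>

text \<open>Convergence of subsets of \<open>G\<close> in the product topology of \<open>{0,1}\<^sup>G\<close>.\<close>

definition subset_limit :: "('a, 'b) monoid_scheme \<Rightarrow> (nat \<Rightarrow> 'a set) \<Rightarrow> 'a set \<Rightarrow> bool"
  where "subset_limit G Q P \<longleftrightarrow>
    (\<forall>g\<in>carrier G. \<forall>\<^sub>F i in sequentially. g \<in> Q i \<longleftrightarrow> g \<in> P)"

definition infinite_path :: "('a, 'b) monoid_scheme \<Rightarrow> 'a set \<Rightarrow> (nat \<Rightarrow> 'a) \<Rightarrow> bool"
  where "infinite_path G S p \<longleftrightarrow>
    (\<forall>i. p i \<in> carrier G) \<and> (\<forall>i. p (Suc i) \<in> p i <#\<^bsub>G\<^esub> S)"

definition infinite_geodesic :: "('a, 'b) monoid_scheme \<Rightarrow> 'a set \<Rightarrow> (nat \<Rightarrow> 'a) \<Rightarrow> bool"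
  where "infinite_geodesic G S p \<longleftrightarrow>
    infinite_path G S p \<and> (\<forall>n. word_dist G S (p 0) (p n) = n)"

definition busemann_horoball :: "('a, 'b) monoid_scheme \<Rightarrow> 'a set \<Rightarrow> 'a set \<Rightarrow> bool"
  where "busemann_horoball G S P \<longleftrightarrow>
    P \<subseteq> carrier G \<and> P \<noteq> {} \<and> P \<noteq> carrier G \<and>
    (\<exists>p. infinite_geodesic G S p \<and> P = (\<Union>n. word_ball G S n (p n)))"

definition horoball :: "('a, 'b) monoid_scheme \<Rightarrow> 'a set \<Rightarrow> 'a set \<Rightarrow> bool"
  where "horoball G S P \<longleftrightarrow>
    P \<subseteq> carrier G \<and> P \<noteq> {} \<and> P \<noteq> carrier G \<and>
    (\<exists>(g :: nat \<Rightarrow> 'a) (n :: nat \<Rightarrow> nat).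
      (\<forall>i. g i \<in> carrier G) \<and> filterlim n at_top sequentially \<and>
      subset_limit G (\<lambda>i. word_ball G S (n i) (g i)) P)"

section \<open>Coarse connectedness\<close>

definition coarsely_connected :: "'a set \<Rightarrow> ('a \<Rightarrow> 'a \<Rightarrow> real) \<Rightarrow> bool"
  where "coarsely_connected M d \<longleftrightarrow>
    (\<exists>t>0. \<forall>x\<in>M. \<forall>y\<in>M. \<exists>(k::nat) (c :: nat \<Rightarrow> 'a).
      c 0 = x \<and> c k = y \<and> (\<forall>i\<le>k. c i \<in> M) \<and> (\<forall>i<k. d (c i) (c (Suc i)) < t))"

text \<open>Any two word metrics coming from finite generating sets are bi-Lipschitz equivalent,
  so the choice of \<open>T\<close> does not matter.\<close>

definition coarsely_connected_in :: "('a, 'b) monoid_scheme \<Rightarrow> 'a set \<Rightarrow> bool"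
  where "coarsely_connected_in G P \<longleftrightarrow>
    (\<exists>T. finite_symmetric_generating_set G T \<and>
      coarsely_connected P (\<lambda>g h. real (word_dist G T g h)))"

section \<open>The lamplighter group\<close>

definition shift :: "int \<Rightarrow> (int \<Rightarrow> bit) \<Rightarrow> (int \<Rightarrow> bit)"
  where "shift m y = (\<lambda>i. y (i - m))"

definition lamplighter :: "((int \<Rightarrow> bit) \<times> int) monoid"
  where "lamplighter =
    \<lparr>carrier = {x. finite {i. x i \<noteq> 0}} \<times> UNIV,
     mult = (\<lambda>(x, m) (y, n). (\<lambda>i. x i + shift m y i, m + n)),
     one = (\<lambda>i. 0, 0)\<rparr>"

definition lamp_a :: "(int \<Rightarrow> bit) \<times> int"
  where "lamp_a = (\<lambda>i. 0, 1)"

definition lamp_b :: "(int \<Rightarrow> bit) \<times> int"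
  where "lamp_b = (\<lambda>i. if i = 0 then 1 else 0, 1)"

definition lamp_gens :: "((int \<Rightarrow> bit) \<times> int) set"
  where "lamp_gens =
    {\<one>\<^bsub>lamplighter\<^esub>, lamp_a, lamp_b, inv\<^bsub>lamplighter\<^esub> lamp_a, inv\<^bsub>lamplighter\<^esub> lamp_b}"

lemma finite_support_shift:
  assumes "finite {i. y i \<noteq> 0}"
  shows "finite {i. shift m y i \<noteq> 0}"
proof -
  have "{i. shift m y i \<noteq> 0} = (\<lambda>i. i + m) ` {i. y i \<noteq> 0}"
    by (force simp: shift_def image_iff intro: exI[of _ "_ - m"])
  then show ?thesis using assms by simp
qed

lemma finite_support_add:
  fixes x y :: "int \<Rightarrow> bit"
  assumes "finite {i. x i \<noteq> 0}" "finite {i. y i \<noteq> 0}"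
  shows "finite {i. x i + y i \<noteq> 0}"
  by (rule finite_subset[OF _ finite_UnI[OF assms]]) auto

lemma group_lamplighter: "group lamplighter"
proof (rule groupI)
  fix u v assume "u \<in> carrier lamplighter" "v \<in> carrier lamplighter"
  then show "u \<otimes>\<^bsub>lamplighter\<^esub> v \<in> carrier lamplighter"
    by (auto simp only: lamplighter_def partial_object.simps monoid.simps mem_Sigma_iff
        mem_Collect_eq split_conv UNIV_I intro!: finite_support_add finite_support_shift)
next
  fix u assume u: "u \<in> carrier lamplighter"
  obtain x m where um: "u = (x, m)" by (cases u)
  have "(shift (-m) x, -m) \<in> carrier lamplighter"
    using u finite_support_shift[of x "-m"] by (simp add: um lamplighter_def)
  moreover have "(shift (-m) x, -m) \<otimes>\<^bsub>lamplighter\<^esub> u = \<one>\<^bsub>lamplighter\<^esub>"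
    unfolding um by (simp add: lamplighter_def fun_eq_iff)
  ultimately show "\<exists>v\<in>carrier lamplighter. v \<otimes>\<^bsub>lamplighter\<^esub> u = \<one>\<^bsub>lamplighter\<^esub>" by blast
next
  fix u v w :: "(int \<Rightarrow> bit) \<times> int"
  show "u \<otimes>\<^bsub>lamplighter\<^esub> v \<otimes>\<^bsub>lamplighter\<^esub> w = u \<otimes>\<^bsub>lamplighter\<^esub> (v \<otimes>\<^bsub>lamplighter\<^esub> w)"
    by (cases u; cases v; cases w)
      (simp only: lamplighter_def shift_def monoid.simps split_conv add.assoc diff_diff_eq)
qed (auto simp: lamplighter_def shift_def)

lemma lamp_gens_carrier: "lamp_a \<in> carrier lamplighter" "lamp_b \<in> carrier lamplighter"
  by (auto simp: lamp_a_def lamp_b_def lamplighter_def)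

lemma mult_lamplighter:
  "(x, m) \<otimes>\<^bsub>lamplighter\<^esub> (y, n) = (\<lambda>i. x i + shift m y i, m + n)"
  by (simp add: lamplighter_def)

lemma finite_symmetric_generating_set_lamp_gens:
  "finite_symmetric_generating_set lamplighter lamp_gens"
proof -
  let ?L = lamplighter
  let ?H = "generate ?L lamp_gens"
  let ?e = "\<lambda>j i::int. if i = j then 1 else (0::bit)"
  interpret group ?L by (rule group_lamplighter)
  have sub: "lamp_gens \<subseteq> carrier ?L"
    by (auto simp: lamp_gens_def lamp_gens_carrier)
  have one: "\<one>\<^bsub>?L\<^esub> = (\<lambda>i. 0, 0)" by (simp add: lamplighter_def)
  have ma: "lamp_a \<otimes>\<^bsub>?L\<^esub> (\<lambda>i. 0, -1) = \<one>\<^bsub>?L\<^esub>" "(\<lambda>i. 0, -1) \<otimes>\<^bsub>?L\<^esub> lamp_a = \<one>\<^bsub>?L\<^esub>"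
    "(\<lambda>i. 0, -1) \<in> carrier ?L"
    by (simp_all add: lamp_a_def lamplighter_def shift_def)
  have inva: "inv\<^bsub>?L\<^esub> lamp_a = (\<lambda>i. 0, -1)"
    using ma inv_equality lamp_gens_carrier by blast
  have genH: "s \<in> lamp_gens \<Longrightarrow> s \<in> ?H" for s by (rule generate.incl)
  have a: "lamp_a \<in> ?H" and b: "lamp_b \<in> ?H" and ia: "(\<lambda>i. 0, -1) \<in> ?H"
    using genH by (auto simp: lamp_gens_def inva)
  have pos: "(\<lambda>i. 0, int n) \<in> ?H" for n
  proof (induction n)
    case 0 show ?case using generate.one[of ?L lamp_gens] by (simp add: one)
  next
    case (Suc n)
    from generate.eng[OF a Suc] show ?case
      by (simp add: lamp_a_def mult_lamplighter shift_def)
  qed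
  have neg: "(\<lambda>i. 0, - int n) \<in> ?H" for n
  proof (induction n)
    case 0 show ?case using generate.one[of ?L lamp_gens] by (simp add: one)
  next
    case (Suc n)
    from generate.eng[OF ia Suc] show ?case
      by (simp add: mult_lamplighter shift_def)
  qed
  have trans: "(\<lambda>i. 0, m) \<in> ?H" for m
    using pos[of "nat m"] neg[of "nat (- m)"] by (cases "m \<ge> 0") auto
  have lamp: "(?e j, 0) \<in> ?H" for j
  proof -
    have "(\<lambda>i. 0, j) \<otimes>\<^bsub>?L\<^esub> (lamp_b \<otimes>\<^bsub>?L\<^esub> (\<lambda>i. 0, -1 - j)) \<in> ?H"
      by (intro generate.eng trans b)
    moreover have "(\<lambda>i. 0, j) \<otimes>\<^bsub>?L\<^esub> (lamp_b \<otimes>\<^bsub>?L\<^esub> (\<lambda>i. 0, -1 - j)) = (?e j, 0)"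
      by (auto simp: lamp_b_def mult_lamplighter shift_def fun_eq_iff)
    ultimately show ?thesis by simp
  qed
  have conf: "finite A \<Longrightarrow> (\<lambda>i. if i \<in> A then 1 else 0, 0) \<in> ?H" for A
  proof (induction A rule: finite_induct)
    case empty show ?case using generate.one[of ?L lamp_gens] by (simp add: one)
  next
    case (insert j A)
    have "(\<lambda>i. ?e j i + (if i \<in> A then 1 else 0)) = (\<lambda>i. if i \<in> insert j A then 1 else 0)"
      using insert.hyps by (auto simp: fun_eq_iff)
    with generate.eng[OF lamp[of j] insert.IH] show ?case
      by (simp add: mult_lamplighter shift_def)
  qed
  have "carrier ?L \<subseteq> ?H"
  proof
    fix u assume u: "u \<in> carrier ?L"
    obtain x m where um: "u = (x, m)" by (cases u)
    have fin: "finite {i. x i \<noteq> 0}" using u by (simp add: um lamplighter_def)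
    have x: "(\<lambda>i. if i \<in> {i. x i \<noteq> 0} then 1 else 0) = x"
      by (auto simp: fun_eq_iff)
    have "(x, 0) \<otimes>\<^bsub>?L\<^esub> (\<lambda>i. 0, m) = u"
      by (simp only: um mult_lamplighter shift_def add_0_left add_0_right)
    with generate.eng[OF conf[OF fin] trans[of m]] show "u \<in> ?H"
      unfolding x by metis
  qed
  moreover have "?H \<subseteq> carrier ?L" by (rule generate_incl[OF sub])
  ultimately show ?thesis
    using sub by (auto simp: finite_symmetric_generating_set_def lamp_gens_def lamp_gens_carrier)
qed

end

(* In the word metric of lamp_gens a generator moves the lamplighter along an edge {j, j + 1} and
   may switch lamp j. The horoball is {(y, k). k \<le> 0}: switching a far away lamp on the positive
   side requires walking there, so bounded steps inside the horoball never do it. It is the limit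
   of the balls of radius 3 i around (x, i), where x lights only lamp - i: getting from (x, i) to
   (y, k) forces a visit to - i to switch that lamp off, which costs 3 i + k steps, and on the way
   back all lamps of y can be adjusted for free. The centres lie on geodesics from the identity
   that first go left to - i and then turn right for ever. *)
theory Submission imports Defs begin

section \<open>Words and word length\<close>

lemma (in group) word_product_closed:
  "set w \<subseteq> carrier G \<Longrightarrow> word_product G w \<in> carrier G"
  by (induction w) (auto simp: word_product_def)

lemma (in group) word_product_append:
  assumes "set v \<subseteq> carrier G" "set w \<subseteq> carrier G"
  shows "word_product G (v @ w) = word_product G v \<otimes> word_product G w"
  using assms
proof (induction v)
  case Nil
  then show ?case using word_product_closed[of w] by (simp add: word_product_def)
next
  case (Cons s v)
  then show ?case using word_product_closed[of v] word_product_closed[of w]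
    by (simp add: word_product_def m_assoc)
qed

text \<open>\<open>word_length\<close> is a \<open>LEAST\<close>, hence meaningful only once some
  word for \<open>g\<close> exists. Induction over \<open>generate\<close> supplies one: symmetry of
  \<open>S\<close> turns inverses into letters, and products become concatenations.\<close>

lemma (in group) obtain_shortest_word:
  assumes S: "finite_symmetric_generating_set G S" and g: "g \<in> carrier G"
  obtains w where "set w \<subseteq> S" "length w = word_length G S g" "word_product G w = g"
proof -
  have sub: "S \<subseteq> carrier G" and inv_mem: "\<And>s. s \<in> S \<Longrightarrow> inv s \<in> S"
    and gen: "generate G S = carrier G"
    using S by (auto simp: finite_symmetric_generating_set_def)
  have single: "\<exists>w. set w \<subseteq> S \<and> word_product G w = s" if "s \<in> S" for s
    using that sub by (intro exI[of _ "[s]"]) (auto simp: word_product_def)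
  have "\<exists>w. set w \<subseteq> S \<and> word_product G w = g"
    using g unfolding gen[symmetric]
  proof (induction rule: generate.induct)
    case one
    show ?case by (intro exI[of _ "[]"]) (simp add: word_product_def)
  next
    case (incl h)
    then show ?case by (rule single)
  next
    case (inv h)
    then show ?case by (intro single inv_mem)
  next
    case (eng h1 h2)
    then obtain v w where "set v \<subseteq> S" "word_product G v = h1" "set w \<subseteq> S" "word_product G w = h2"
      by blast
    then show ?case using word_product_append[of v w] sub
      by (intro exI[of _ "v @ w"]) auto
  qed
  then have "\<exists>l w. set w \<subseteq> S \<and> length w = l \<and> word_product G w = g" by blast
  from LeastI_ex[OF this] show ?thesis using that unfolding word_length_def by blast
qed

lemma word_length_le:
  "set w \<subseteq> S \<Longrightarrow> word_length G S (word_product G w) \<le> length w"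
  unfolding word_length_def by (rule Least_le) blast

lemma (in group) word_length_mult_le:
  assumes S: "finite_symmetric_generating_set G S" and g: "g \<in> carrier G" and h: "h \<in> carrier G"
  shows "word_length G S (g \<otimes> h) \<le> word_length G S g + word_length G S h"
proof -
  obtain v w where v: "set v \<subseteq> S" "length v = word_length G S g" "word_product G v = g"
    and w: "set w \<subseteq> S" "length w = word_length G S h" "word_product G w = h"
    using obtain_shortest_word[OF S] g h by metis
  have "S \<subseteq> carrier G" using S by (simp add: finite_symmetric_generating_set_def)
  then have "word_product G (v @ w) = g \<otimes> h"
    using word_product_append[of v w] v w by auto
  then show ?thesis using word_length_le[of "v @ w" S G] v w by simp
qed

lemma (in group) word_length_generator_le:
  assumes "s \<in> S" "S \<subseteq> carrier G"
  shows "word_length G S s \<le> 1"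
  using word_length_le[of "[s]" S G] assms by (auto simp: word_product_def)

text \<open>There are only finitely many words of bounded length over a finite alphabet. This holds
  for every finite generating set, so coarse connectedness can later be refuted for an arbitrary
  \<open>T\<close>.\<close>

lemma (in group) finite_word_ball_one:
  assumes S: "finite_symmetric_generating_set G S"
  shows "finite {g \<in> carrier G. word_length G S g \<le> n}"
proof (rule finite_subset)
  show "{g \<in> carrier G. word_length G S g \<le> n}
      \<subseteq> word_product G ` {w. set w \<subseteq> S \<and> length w \<le> n}"
  proof
    fix g assume "g \<in> {g \<in> carrier G. word_length G S g \<le> n}"
    then have "g \<in> carrier G" "word_length G S g \<le> n" by auto
    then show "g \<in> word_product G ` {w. set w \<subseteq> S \<and> length w \<le> n}"
      by (auto intro: obtain_shortest_word[OF S])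
  qed
  show "finite (word_product G ` {w. set w \<subseteq> S \<and> length w \<le> n})"
    using S by (intro finite_imageI finite_lists_length_le)
      (simp add: finite_symmetric_generating_set_def)
qed

section \<open>Word length in the lamplighter group\<close>

interpretation lamplighter: group lamplighter
  by (rule group_lamplighter)

lemmas lamp_gens_generate = finite_symmetric_generating_set_lamp_gens

lemma lamp_gens_subset: "lamp_gens \<subseteq> carrier lamplighter"
  using lamp_gens_generate by (simp add: finite_symmetric_generating_set_def)

section \<open>Coordinates and lower bounds in the lamplighter group\<close>

lemma mem_carrier_lamplighter:
  "(x, m) \<in> carrier lamplighter \<longleftrightarrow> finite {i. x i \<noteq> 0}"
  by (simp add: lamplighter_def)

lemma one_lamplighter: "\<one>\<^bsub>lamplighter\<^esub> = (\<lambda>i. 0, 0)"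
  by (simp add: lamplighter_def)

definition lamp :: "int \<Rightarrow> int \<Rightarrow> bit"
  where "lamp j = (\<lambda>i. if i = j then 1 else 0)"

lemma zero_mem_carrier: "(\<lambda>i. 0, m) \<in> carrier lamplighter"
  by (simp add: mem_carrier_lamplighter)

lemma lamp_mem_carrier: "(lamp j, m) \<in> carrier lamplighter"
  by (simp add: mem_carrier_lamplighter lamp_def)

lemma inv_lamplighter:
  assumes "(x, m) \<in> carrier lamplighter"
  shows "inv\<^bsub>lamplighter\<^esub> (x, m) = (\<lambda>i. x (i + m), - m)"
proof (rule lamplighter.inv_equality)
  show "(\<lambda>i. x (i + m), - m) \<otimes>\<^bsub>lamplighter\<^esub> (x, m) = \<one>\<^bsub>lamplighter\<^esub>"
    by (simp add: mult_lamplighter one_lamplighter shift_def)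
  show "(\<lambda>i. x (i + m), - m) \<in> carrier lamplighter"
    using assms finite_support_shift[of x "- m"]
    by (simp add: mem_carrier_lamplighter shift_def)
qed (fact assms)

text \<open>The edge from j to j + 1 carries lamp j. Crossing it rightwards from 0 may switch lamp
  0; crossing leftwards from 0 uses the edge from -1 to 0, which is why the inverse of
  \<open>lamp_b\<close> carries \<open>lamp (-1)\<close>.\<close>

lemma lamp_gens_eq:
  "lamp_gens = {(\<lambda>i. 0, 0), (\<lambda>i. 0, 1), (lamp 0, 1), (\<lambda>i. 0, -1), (lamp (-1), -1)}"
proof -
  have "inv\<^bsub>lamplighter\<^esub> lamp_a = (\<lambda>i. 0, -1)"
    unfolding lamp_a_def by (rule inv_lamplighter[OF zero_mem_carrier])
  moreover have b: "lamp_b = (lamp 0, 1)"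
    by (simp add: lamp_b_def lamp_def)
  moreover have "inv\<^bsub>lamplighter\<^esub> lamp_b = (lamp (-1), -1)"
    unfolding b inv_lamplighter[OF lamp_mem_carrier] by (auto simp: lamp_def)
  ultimately show ?thesis
    by (simp add: lamp_gens_def one_lamplighter lamp_a_def)
qed

text \<open>The difference of two elements is seen from the first walker: the lamp at absolute
  position j appears at index j - m.\<close>

lemma inv_mult_lamplighter:
  assumes "(x, m) \<in> carrier lamplighter"
  shows "inv\<^bsub>lamplighter\<^esub> (x, m) \<otimes>\<^bsub>lamplighter\<^esub> (y, n) = (\<lambda>i. x (i + m) + y (i + m), n - m)"
  by (simp add: inv_lamplighter[OF assms] mult_lamplighter shift_def)

text \<open>A word is a walk from 0 to m, and a lamp j can only be lit by a walk that visits j,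
  which takes at least the distance from 0 to j plus that from j to m.\<close>

lemma length_ge_word_product:
  assumes "set w \<subseteq> lamp_gens" "word_product lamplighter w = (x, m)"
  shows "\<bar>m\<bar> \<le> int (length w)" "x j \<noteq> 0 \<Longrightarrow> \<bar>j\<bar> + \<bar>m - j\<bar> \<le> int (length w)"
proof -
  have "\<bar>m\<bar> \<le> int (length w) \<and> (\<forall>j. x j \<noteq> 0 \<longrightarrow> \<bar>j\<bar> + \<bar>m - j\<bar> \<le> int (length w))"
    using assms
  proof (induction w arbitrary: x m)
    case Nil
    then show ?case by (auto simp: word_product_def one_lamplighter)
  next
    case (Cons s w)
    obtain z c where s: "s = (z, c)" by (cases s)
    obtain y n where yn: "word_product lamplighter w = (y, n)"
      by (cases "word_product lamplighter w")
    \<comment> \<open>The first letter is peeled off; the remaining walk starts at c, so its lamps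
      are translated by c.\<close>
    have "(z, c) \<otimes>\<^bsub>lamplighter\<^esub> (y, n) = (x, m)"
      using Cons.prems yn s by (simp add: word_product_def)
    then have x: "x = (\<lambda>i. z i + y (i - c))" and m: "m = c + n"
      by (auto simp: mult_lamplighter shift_def)
    have IH: "\<bar>n\<bar> \<le> int (length w)" "\<And>j. y j \<noteq> 0 \<Longrightarrow> \<bar>j\<bar> + \<bar>n - j\<bar> \<le> int (length w)"
      using Cons.IH[OF _ yn] Cons.prems by auto
    have zc: "(z, c) \<in> lamp_gens" using Cons.prems s by simp
    then have c: "\<bar>c\<bar> \<le> 1" by (auto simp: lamp_gens_eq)
    have "\<bar>j\<bar> + \<bar>m - j\<bar> \<le> int (length (s # w))" if xj: "x j \<noteq> 0" for j
    proof (cases "y (j - c) = 0")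
      \<comment> \<open>The tail leaves lamp j off, so the first letter lights it. Then either the
        walk starts at j = 0, or its first step leads to j = -1; the bound on the displacement n of
        the tail suffices.\<close>
      case True
      then have "z j \<noteq> 0" using xj x by auto
      with zc have "(j = 0 \<or> j = -1) \<and> (c = 1 \<and> j = 0 \<or> c = -1 \<and> j = -1)"
        by (auto simp: lamp_gens_eq lamp_def split: if_splits)
      then show ?thesis using IH(1) m by auto
    next
      case False
      from IH(2)[OF this] show ?thesis using m c by auto
    qed
    moreover have "\<bar>m\<bar> \<le> int (length (s # w))" using IH(1) m c by auto
    ultimately show ?case by blast
  qed
  then show "\<bar>m\<bar> \<le> int (length w)" "x j \<noteq> 0 \<Longrightarrow> \<bar>j\<bar> + \<bar>m - j\<bar> \<le> int (length w)"
    by blast+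
qed

lemma word_length_ge:
  assumes "(x, m) \<in> carrier lamplighter"
  shows "\<bar>m\<bar> \<le> int (word_length lamplighter lamp_gens (x, m))"
    "x j \<noteq> 0 \<Longrightarrow> \<bar>j\<bar> + \<bar>m - j\<bar> \<le> int (word_length lamplighter lamp_gens (x, m))"
proof -
  obtain w where w: "set w \<subseteq> lamp_gens"
    "length w = word_length lamplighter lamp_gens (x, m)" "word_product lamplighter w = (x, m)"
    using lamplighter.obtain_shortest_word[OF lamp_gens_generate assms] .
  show "\<bar>m\<bar> \<le> int (word_length lamplighter lamp_gens (x, m))"
    "x j \<noteq> 0 \<Longrightarrow> \<bar>j\<bar> + \<bar>m - j\<bar> \<le> int (word_length lamplighter lamp_gens (x, m))"
    using length_ge_word_product[OF w(1,3)] w(2) by auto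
qed

section \<open>Upper bounds from explicit walks\<close>

lemma word_length_right_le: "word_length lamplighter lamp_gens (\<lambda>i. 0, int r) \<le> r"
proof (induction r)
  case 0
  show ?case using word_length_le[of "[]" lamp_gens lamplighter]
    by (simp add: word_product_def one_lamplighter)
next
  case (Suc r)
  have "(\<lambda>i. 0, int (Suc r)) = (\<lambda>i. 0, int r) \<otimes>\<^bsub>lamplighter\<^esub> (\<lambda>i. 0, 1)"
    by (simp add: mult_lamplighter shift_def)
  moreover have "word_length lamplighter lamp_gens (\<lambda>i. 0, 1) \<le> 1"
    by (rule lamplighter.word_length_generator_le[OF _ lamp_gens_subset]) (simp add: lamp_gens_eq)
  ultimately show ?case
    using lamplighter.word_length_mult_le[OF lamp_gens_generate zero_mem_carrier zero_mem_carrier,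
        of "int r" 1] Suc.IH by simp
qed

text \<open>The walk from 0 straight to -l crosses exactly the edges of the lamps -l, ..., -1, so
  each of them can be set at no extra cost.\<close>

lemma word_length_left_le:
  assumes "\<And>i. z i \<noteq> 0 \<Longrightarrow> - int l \<le> i \<and> i < 0"
  shows "word_length lamplighter lamp_gens (z, - int l) \<le> l"
  using assms
proof (induction l arbitrary: z)
  case 0
  then have "z = (\<lambda>i. 0)" by force
  then show ?case using word_length_right_le[of 0] by simp
next
  case (Suc l)
  let ?j = "- int (Suc l)"
  define y where "y = z(?j := 0)"
  have y: "- int l \<le> i \<and> i < 0" if "y i \<noteq> 0" for i
  proof -
    have "z i \<noteq> 0" "i \<noteq> ?j" using that by (auto simp: y_def split: if_splits)
    then show ?thesis using Suc.prems[of i] by auto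
  qed
  have "finite {i. y i \<noteq> 0}"
    by (rule finite_subset[of _ "{- int l..<0}"]) (use y in auto)
  then have yc: "(y, - int l) \<in> carrier lamplighter" by (simp add: mem_carrier_lamplighter)
  \<comment> \<open>The last letter sets the leftmost lamp: read at position -l,
    \<open>lamp (-1)\<close> lands on -l - 1, which is \<open>?j\<close>.\<close>
  define s where "s = ((if z ?j = 0 then (\<lambda>i. 0) else lamp (-1)), -1 :: int)"
  have s: "s \<in> lamp_gens" by (simp add: s_def lamp_gens_eq)
  have "i + int l = -1 \<longleftrightarrow> i = -1 - int l" for i by linarith
  then have "(y, - int l) \<otimes>\<^bsub>lamplighter\<^esub> s = (z, ?j)"
    by (auto simp: s_def y_def mult_lamplighter shift_def lamp_def fun_eq_iff)
  then have "word_length lamplighter lamp_gens (z, ?j)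
      \<le> word_length lamplighter lamp_gens (y, - int l) + word_length lamplighter lamp_gens s"
    using lamplighter.word_length_mult_le[OF lamp_gens_generate yc, of s] s lamp_gens_subset
    by auto
  also have "\<dots> \<le> l + 1"
    by (intro add_mono Suc.IH y lamplighter.word_length_generator_le s lamp_gens_subset)
  finally show ?case by simp
qed

section \<open>Geodesics that turn around\<close>

text \<open>Lamp -a is lit by the first step back to the right, so it is still off at time a. At
  time 3a the walker stands at a.\<close>

definition turning :: "nat \<Rightarrow> nat \<Rightarrow> (int \<Rightarrow> bit) \<times> int"
  where "turning a n =
    (if n \<le> a then (\<lambda>i. 0, - int n) else (lamp (- int a), int n - 2 * int a))"

lemma turning_carrier: "turning a n \<in> carrier lamplighter"
  by (simp add: turning_def zero_mem_carrier lamp_mem_carrier)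

lemma turning_zero: "turning a 0 = \<one>\<^bsub>lamplighter\<^esub>"
  by (simp add: turning_def one_lamplighter)

lemma turning_step: "\<exists>s\<in>lamp_gens. turning a (Suc n) = turning a n \<otimes>\<^bsub>lamplighter\<^esub> s"
proof -
  consider "n < a" | "n = a" | "n > a" by linarith
  then show ?thesis
  proof cases
    case 1
    then show ?thesis
      by (intro bexI[of _ "(\<lambda>i. 0, -1)"])
        (auto simp: turning_def mult_lamplighter shift_def lamp_gens_eq)
  next
    case 2
    then show ?thesis
      \<comment> \<open>At the turning point \<open>lamp_b\<close> is read at position -a and so
        switches lamp -a.\<close>
      by (intro bexI[of _ "(lamp 0, 1)"])
        (auto simp: turning_def mult_lamplighter shift_def lamp_gens_eq lamp_def fun_eq_iff)
  next
    case 3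
    then show ?thesis
      by (intro bexI[of _ "(\<lambda>i. 0, 1)"])
        (auto simp: turning_def mult_lamplighter shift_def lamp_gens_eq)
  qed
qed

lemma word_length_turning_le: "word_length lamplighter lamp_gens (turning a n) \<le> n"
proof (induction n)
  case 0
  show ?case using word_length_right_le[of 0] by (simp add: turning_def)
next
  case (Suc n)
  obtain s where s: "s \<in> lamp_gens" "turning a (Suc n) = turning a n \<otimes>\<^bsub>lamplighter\<^esub> s"
    using turning_step by blast
  then show ?case
    using lamplighter.word_length_mult_le[OF lamp_gens_generate turning_carrier, of s a n]
      lamplighter.word_length_generator_le[OF s(1) lamp_gens_subset] lamp_gens_subset Suc.IH
    by fastforce
qed

text \<open>Up to time a the walker is at -n, already n + k away from k. Later lamp -a is lit and
  has to be switched off: n - a steps back to -a and a + k steps on to k, again n + k. For positive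
  k the point therefore escapes every ball of radius n around \<open>turning a n\<close>.\<close>

lemma word_dist_turning_ge:
  assumes h: "(y, k) \<in> carrier lamplighter" and k: "k \<ge> 0" and y: "y (- int a) = 0"
  shows "int n + k \<le> int (word_dist lamplighter lamp_gens (turning a n) (y, k))"
proof -
  obtain x m where xm: "turning a n = (x, m)" by (cases "turning a n")
  let ?u = "(\<lambda>i. x (i + m) + y (i + m), k - m)"
  have c: "(x, m) \<in> carrier lamplighter" using turning_carrier xm by metis
  have u: "inv\<^bsub>lamplighter\<^esub> (x, m) \<otimes>\<^bsub>lamplighter\<^esub> (y, k) = ?u"
    by (rule inv_mult_lamplighter[OF c])
  have "?u \<in> carrier lamplighter"
    unfolding u[symmetric] using c h by blast
  note ge = word_length_ge[OF this]
  show ?thesis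
  proof (cases "n \<le> a")
    case True
    then have "m = - int n" using xm by (simp add: turning_def)
    then show ?thesis unfolding word_dist_def xm u using ge(1) k by simp
  next
    case False
    then have x: "x = lamp (- int a)" and m: "m = int n - 2 * int a"
      using xm by (auto simp: turning_def)
    \<comment> \<open>The argument equals -a, so a - n is the index of lamp -a as seen from the
      walker at m.\<close>
    have "x (int a - int n + m) + y (int a - int n + m) \<noteq> 0"
      using y by (simp add: x m lamp_def)
    from ge(2)[OF this] show ?thesis unfolding word_dist_def xm u using k m False by simp
  qed
qed

lemma infinite_geodesic_turning: "infinite_geodesic lamplighter lamp_gens (turning a)"
proof -
  have "word_dist lamplighter lamp_gens (turning a 0) (turning a n) = n" for n
  proof -
    have "word_dist lamplighter lamp_gens (turning a 0) (turning a n)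
        = word_length lamplighter lamp_gens (turning a n)"
      using turning_carrier by (simp add: word_dist_def turning_zero)
    moreover have "int n \<le> int (word_length lamplighter lamp_gens (turning a n))"
    proof (cases "n \<le> a")
      case True
      then show ?thesis using word_length_ge(1)[OF zero_mem_carrier, of "- int n"]
        by (simp add: turning_def)
    next
      case False
      \<comment> \<open>The lit lamp forces a visit to -a: a steps there and n - a steps from there
        to n - 2a.\<close>
      have "lamp (- int a) (- int a) \<noteq> 0" by (simp add: lamp_def)
      from word_length_ge(2)[where x = "lamp (- int a)", OF lamp_mem_carrier this,
          of "int n - 2 * int a"] False
      show ?thesis by (simp add: turning_def)
    qed
    ultimately show ?thesis using word_length_turning_le[of a n] by simp
  qed
  then show ?thesis
    using turning_step[of a] turning_carrier[of a]
    by (auto simp: infinite_geodesic_def infinite_path_def l_coset_def)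
qed

text \<open>From a, walk left to -a in 2a steps, setting all lamps from -a to a - 1 as in y, and
  then right to k in k + a steps, which is at most a because k is not positive.\<close>

lemma mem_word_ball_turning:
  assumes k: "- int a \<le> k" "k \<le> 0" and y: "\<And>i. y i \<noteq> 0 \<Longrightarrow> - int a \<le> i \<and> i < int a"
  shows "(y, k) \<in> word_ball lamplighter lamp_gens (3 * a) (turning a (3 * a))"
proof -
  have "finite {i. y i \<noteq> 0}"
    by (rule finite_subset[of _ "{- int a..<int a}"]) (use y in auto)
  then have yc: "(y, k) \<in> carrier lamplighter" by (simp add: mem_carrier_lamplighter)
  show ?thesis
  proof (cases "a = 0")
    \<comment> \<open>For a = 0 the centre is the identity with lamp 0 still off, so the formula for
      the second branch of \<open>turning\<close> does not apply.\<close>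
    case True
    then have "y = (\<lambda>i. 0)" "k = 0" using y k by force+
    then show ?thesis using True yc word_length_right_le[of 0]
      by (simp add: word_ball_def word_dist_def turning_zero flip: one_lamplighter)
  next
    case False
    define z where "z = (\<lambda>i. lamp (- int a) (i + int a) + y (i + int a))"
    have z: "- int (2 * a) \<le> i \<and> i < 0" if "z i \<noteq> 0" for i
    proof -
      have "i + int a = - int a \<or> y (i + int a) \<noteq> 0"
        using that by (auto simp: z_def lamp_def split: if_splits)
      then show ?thesis using y[of "i + int a"] False by auto
    qed
    have "finite {i. z i \<noteq> 0}"
      by (rule finite_subset[of _ "{- int (2 * a)..<0}"]) (use z in auto)
    then have zc: "(z, - int (2 * a)) \<in> carrier lamplighter"
      by (simp add: mem_carrier_lamplighter)
    \<comment> \<open>The number of steps from the turning point -a back to k.\<close>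
    define r where "r = nat (k + int a)"
    have "turning a (3 * a) = (lamp (- int a), int a)"
      using False by (simp add: turning_def)
    then have "inv\<^bsub>lamplighter\<^esub> turning a (3 * a) \<otimes>\<^bsub>lamplighter\<^esub> (y, k) = (z, k - int a)"
      by (simp add: inv_mult_lamplighter[OF lamp_mem_carrier] z_def)
    also have "\<dots> = (z, - int (2 * a)) \<otimes>\<^bsub>lamplighter\<^esub> (\<lambda>i. 0, int r)"
      using k by (simp only: mult_lamplighter shift_def add_0_right) (simp add: r_def)
    finally have "word_dist lamplighter lamp_gens (turning a (3 * a)) (y, k)
        \<le> word_length lamplighter lamp_gens (z, - int (2 * a))
          + word_length lamplighter lamp_gens (\<lambda>i. 0, int r)"
      unfolding word_dist_def
      using lamplighter.word_length_mult_le[OF lamp_gens_generate zc zero_mem_carrier] by simp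
    also have "\<dots> \<le> 2 * a + r"
      by (intro add_mono word_length_left_le word_length_right_le z)
    also have "\<dots> \<le> 3 * a" using k by (simp add: r_def)
    finally show ?thesis using yc by (simp add: word_ball_def)
  qed
qed

section \<open>The limit horoball\<close>

definition left_half :: "((int \<Rightarrow> bit) \<times> int) set"
  where "left_half = {(y, k) \<in> carrier lamplighter. k \<le> 0}"

lemma mem_left_half:
  "(y, k) \<in> left_half \<longleftrightarrow> (y, k) \<in> carrier lamplighter \<and> k \<le> 0"
  by (auto simp: left_half_def)

lemma left_half_proper: "left_half \<subseteq> carrier lamplighter" "left_half \<noteq> {}"
  "left_half \<noteq> carrier lamplighter"
proof -
  show "left_half \<subseteq> carrier lamplighter" by (auto simp: left_half_def)
  have "(\<lambda>i. 0, 0) \<in> left_half" "(\<lambda>i. 0, 1) \<notin> left_half"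
    using zero_mem_carrier by (auto simp: mem_left_half)
  then show "left_half \<noteq> {}" "left_half \<noteq> carrier lamplighter"
    using zero_mem_carrier by blast+
qed

text \<open>A sandwich serving both limits: \<open>Q\<close> may be the balls of radius 3i
  themselves or the full Busemann unions, since both bounds converge to
  \<open>left_half\<close>.\<close>

lemma subset_limit_left_half:
  assumes lower: "\<And>i. word_ball lamplighter lamp_gens (3 * i) (turning i (3 * i)) \<subseteq> Q i"
    and upper: "\<And>i. Q i \<subseteq> (\<Union>n. word_ball lamplighter lamp_gens n (turning i n))"
  shows "subset_limit lamplighter Q left_half"
  unfolding subset_limit_def
proof
  fix g assume g: "g \<in> carrier lamplighter"
  obtain y k where yk: "g = (y, k)" by (cases g)
  then have yc: "(y, k) \<in> carrier lamplighter" using g by simp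
  then have "finite (insert k {i. y i \<noteq> 0})" by (simp add: mem_carrier_lamplighter)
  then obtain N where N: "\<And>i. i \<in> insert k {i. y i \<noteq> 0} \<Longrightarrow> \<bar>i\<bar> \<le> N"
    using finite_imageI[of "insert k {i. y i \<noteq> 0}" abs]
    by (meson Max_ge imageI)
  \<comment> \<open>Once i exceeds N, all lit lamps of y and the position k lie strictly between -i
    and i; in particular lamp -i of y is off.\<close>
  show "\<forall>\<^sub>F i in sequentially. g \<in> Q i \<longleftrightarrow> g \<in> left_half"
    unfolding eventually_sequentially
  proof (intro exI[of _ "nat N + 1"] allI impI)
    fix i assume "nat N + 1 \<le> i"
    then have i: "N < int i" by linarith
    show "g \<in> Q i \<longleftrightarrow> g \<in> left_half"
    proof (cases "k \<le> 0")
      case True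
      have "- int i \<le> j \<and> j < int i" if "y j \<noteq> 0" for j
        using N[of j] that i by auto
      moreover have "- int i \<le> k" using N[of k] i by auto
      ultimately have "g \<in> Q i"
        using lower mem_word_ball_turning[of i k y] True yk by blast
      then show ?thesis using True yc yk by (simp add: mem_left_half)
    next
      case False
      have "y (- int i) = 0" using N[of "- int i"] i by force
      then have "(y, k) \<notin> word_ball lamplighter lamp_gens n (turning i n)" for n
        using word_dist_turning_ge[OF yc, of i n] False by (auto simp: word_ball_def)
      then have "g \<notin> Q i" using upper yk by blast
      then show ?thesis using False yk by (simp add: mem_left_half)
    qed
  qed
qed

lemma busemann_horoball_turning:
  "busemann_horoball lamplighter lamp_gens
    (\<Union>n. word_ball lamplighter lamp_gens n (turning a n))"
    (is "busemann_horoball _ _ ?Q")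
proof -
  \<comment> \<open>Properness of the union: the unlit configuration at position 1 misses every ball
    by at least one step.\<close>
  have "n < word_dist lamplighter lamp_gens (turning a n) (\<lambda>i. 0, 1)" for n
    using word_dist_turning_ge[OF zero_mem_carrier, of 1 n a] by simp
  then have "(\<lambda>i. 0, 1) \<notin> ?Q" by (simp add: word_ball_def not_le)
  moreover have "(\<lambda>i. 0, 0) \<in> ?Q"
    using mem_word_ball_turning[of a 0 "\<lambda>i. 0"] by auto
  moreover have "?Q \<subseteq> carrier lamplighter" by (auto simp: word_ball_def)
  ultimately show ?thesis
    unfolding busemann_horoball_def
    using infinite_geodesic_turning zero_mem_carrier by blast
qed

lemma horoball_left_half: "horoball lamplighter lamp_gens left_half"
  unfolding horoball_def
proof (intro conjI left_half_proper exI)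
  show "subset_limit lamplighter
      (\<lambda>i. word_ball lamplighter lamp_gens (3 * i) (turning i (3 * i))) left_half"
    by (rule subset_limit_left_half) auto
  show "filterlim (\<lambda>i::nat. 3 * i) at_top sequentially"
    by (rule filterlim_subseq) (simp add: strict_mono_def)
qed (simp add: turning_carrier)

section \<open>Failure of coarse connectedness\<close>

lemma not_coarsely_connected_left_half:
  "\<not> coarsely_connected_in lamplighter left_half"
proof
  assume "coarsely_connected_in lamplighter left_half"
  then obtain T where T: "finite_symmetric_generating_set lamplighter T"
    and cc: "coarsely_connected left_half (\<lambda>g h. real (word_dist lamplighter T g h))"
    unfolding coarsely_connected_in_def by blast
  from cc obtain t where conn: "\<forall>x\<in>left_half. \<forall>y\<in>left_half.
      \<exists>(k::nat) c. c 0 = x \<and> c k = y \<and> (\<forall>i\<le>k. c i \<in> left_half) \<and>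
        (\<forall>i<k. real (word_dist lamplighter T (c i) (c (Suc i))) < t)"
    unfolding coarsely_connected_def by (elim exE conjE)
  \<comment> \<open>\<open>B\<close> contains all possible jumps of a chain, and \<open>F\<close>
    all lamps that a jump can switch, relative to its starting position.\<close>
  define B where "B = {g \<in> carrier lamplighter. word_length lamplighter T g \<le> nat \<lceil>t\<rceil>}"
  define F where "F = (\<Union>g\<in>B. {i. fst g i \<noteq> 0})"
  have "finite B" unfolding B_def by (rule lamplighter.finite_word_ball_one[OF T])
  then have "finite F"
    unfolding F_def by (rule finite_UN_I) (auto simp: B_def mem_carrier_lamplighter)
  then have "bdd_above F" by (rule bdd_above_finite)
  then obtain M where M: "\<And>i. i \<in> F \<Longrightarrow> i \<le> M"
    by (auto simp: bdd_above_def)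
  \<comment> \<open>A lamp to the right of everything in \<open>F\<close>; it will be invariant
    along chains inside \<open>left_half\<close>.\<close>
  define C where "C = M + 1"
  have C: "i < C" if "i \<in> F" for i using M[OF that] by (simp add: C_def)
  have step: "fst h C = fst g C"
    if g: "g \<in> left_half" and h: "h \<in> left_half" and d: "real (word_dist lamplighter T g h) < t"
    for g h
  proof -
    obtain x m y n where xm: "g = (x, m)" "h = (y, n)" by (cases g, cases h)
    have gc: "(x, m) \<in> carrier lamplighter" "(y, n) \<in> carrier lamplighter" and m: "m \<le> 0"
      using g h xm by (auto simp: mem_left_half)
    let ?u = "(\<lambda>i. x (i + m) + y (i + m), n - m)"
    have u: "inv\<^bsub>lamplighter\<^esub> (x, m) \<otimes>\<^bsub>lamplighter\<^esub> (y, n) = ?u"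
      by (rule inv_mult_lamplighter[OF gc(1)])
    have "?u \<in> carrier lamplighter" unfolding u[symmetric] using gc by blast
    moreover have "word_length lamplighter T ?u \<le> nat \<lceil>t\<rceil>"
      using d unfolding word_dist_def xm u by linarith
    ultimately have "?u \<in> B" by (simp add: B_def)
    \<comment> \<open>From a walker at m, lamp C has relative index C - m, which is at least C
      because m is not positive; so the jump cannot switch it.\<close>
    moreover have "C - m \<notin> F" using C[of "C - m"] m by auto
    ultimately have "fst ?u (C - m) = 0" unfolding F_def by blast
    then have "x C + y C = 0" by simp
    then show ?thesis using xm by (cases "x C"; cases "y C") auto
  qed
  \<comment> \<open>Two points of \<open>left_half\<close> that differ in the invariant lamp C
    cannot be joined by a chain.\<close>
  have "(\<lambda>i. 0, 0) \<in> left_half" "(lamp C, 0) \<in> left_half"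
    by (simp_all add: mem_left_half zero_mem_carrier lamp_mem_carrier)
  from conn[rule_format, OF this] obtain k c where c: "c 0 = (\<lambda>i. 0, 0)" "c k = (lamp C, 0)"
    and mem: "\<forall>i\<le>k. c i \<in> left_half"
    and near: "\<forall>i<k. real (word_dist lamplighter T (c i) (c (Suc i))) < t"
    by blast
  have "fst (c i) C = 0" if "i \<le> k" for i
    using that
  proof (induction i)
    case 0
    show ?case by (simp add: c)
  next
    case (Suc i)
    then show ?case using step[of "c i" "c (Suc i)"] mem near by simp
  qed
  from this[of k] show False by (simp add: c lamp_def)
qed

theorem theorem2:
  "\<exists>P. horoball lamplighter lamp_gens P \<and>
       \<not> coarsely_connected_in lamplighter P \<and>
       (\<exists>Q. (\<forall>i. busemann_horoball lamplighter lamp_gens (Q i)) \<and> subset_limit lamplighter Q P)"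
proof (intro exI conjI allI)
  show "horoball lamplighter lamp_gens left_half" by (rule horoball_left_half)
  show "\<not> coarsely_connected_in lamplighter left_half" by (rule not_coarsely_connected_left_half)
  show "busemann_horoball lamplighter lamp_gens
      (\<Union>n. word_ball lamplighter lamp_gens n (turning i n))" for i
    by (rule busemann_horoball_turning)
  show "subset_limit lamplighter
      (\<lambda>i. \<Union>n. word_ball lamplighter lamp_gens n (turning i n)) left_half"
    by (rule subset_limit_left_half) auto
qed

end
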